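(* Let $x_0\in\mathbf{R}^n$ be fixed, and let $f$ be a real-valued function with the second order Taylor expansion about $x_0$, $f(x)=f(x_0)+(x-x_0)^T\nabla f(x_0)+\tfrac12(x-x_0)^TG(x-x_0)+\mathcal{O}(h^3)$ for $\|x-x_0\|_2=\mathcal{O}(h)$, where $G=\nabla^2f(x_0)$. Let $V_+=\begin{bmatrix}v_1&\dots&v_{n+1}\end{bmatrix}\in\mathbf{R}^{n\times(n+1)}$ be the matrix of unit arms of the aligned regular simplex (defined in the context). Choose $h_1=\mathcal{O}(h)$ and $h_2=\mathcal{O}(h)$ with $h_1\neq h_2$, and for $i\in\{1,2\}$ let $$g_i=\frac1{h_i}(V_+V_+^T)^{-1}V_+\,\delta\mathbf{f}_+^{(i)},\qquad \delta\mathbf{f}_+^{(i)}=\left(f(x_0+h_iv_j)-f(x_0)\right)_{j=1}^{n+1}\in\mathbf{R}^{n+1},$$ be the two aligned regular simplex gradients at $x_0$, formed with the same centroid $x_0$ and the same directions $v_1,\dots,v_{n+1}$. Then $$\nabla f(x_0)=g_{12}+\mathcal{O}(h^2),\qquad\text{where}\qquad g_{12}=\frac{h_2g_1-h_1g_2}{h_2-h_1},$$ i.e. $g_{12}$ is an order $h^2$ accurate approximation to the true gradient at $x_0$. Moreover, if $h_2$ is chosen to be a multiple of $h_1$, $h_2=\eta h_1$ (with $\eta\neq1$), then $$g_{12}=\frac{\eta}{\eta-1}g_1-\frac1{\eta-1}g_2.$$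
   Context: $e$ denotes the all-ones vector of appropriate size and $I$ the $n\times n$ identity matrix. Let $\alpha=\sqrt{\frac{n+1}{n}}$, let $\gamma$ be either of the two numbers $\frac1n\left(1\pm\frac1{\sqrt{n+1}}\right)$, let $V=\alpha(I-\gamma ee^T)\in\mathbf{R}^{n\times n}$ and $V_+=\begin{bmatrix}V&-Ve\end{bmatrix}$, with columns $v_1,\dots,v_{n+1}$. These columns are unit vectors, any two of them have inner product $-\frac1n$, and the points $x_0+h_iv_j$, $j=1,\dots,n+1$, are the vertices of a regular simplex with centroid $x_0$ and radius $h_i$. The vector $g_i$ is the least squares solution $g$ of $V_+^Tg=\frac1{h_i}\delta\mathbf{f}_+^{(i)}$ and is an $\mathcal{O}(h)$ approximation to $\nabla f(x_0)$. The multiplier $\eta$ may be negative; a negative $h_2$ is interpreted as a simplex of radius $|h_2|$ obtained by reflecting the arms through $x_0$ (the paper describes this as a rotation by $180^\circ$).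
   Formalization: Besides h_1≠h_2 (both nonzero), the formal theorem assumes h_1=O(h_2-h_1), i.e. h_2/h_1 stays away from 1; under the stated Taylor hypothesis alone the O(h^2) claim can fail when h_2/h_1 tends to 1. *)

theory Defs
  imports "HOL-Analysis.Analysis" "HOL-Library.Landau_Symbols"
begin

text \<open>
  The ambient space is \<open>real ^ 'n\<close> with \<open>n = CARD('n)\<close>. The \<open>n + 1\<close> arms of the simplex are indexed
  by \<open>'n option\<close>: the column \<open>Some j\<close> is the \<open>j\<close>-th column of \<open>V\<close>, the column \<open>None\<close> is \<open>- V e\<close>.
\<close>

definition simplex_alpha :: "'n::finite itself \<Rightarrow> real" where
  "simplex_alpha _ = sqrt ((real CARD('n) + 1) / real CARD('n))"

definition simplex_gamma :: "'n::finite itself \<Rightarrow> real \<Rightarrow> bool" where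
  "simplex_gamma _ \<gamma> \<longleftrightarrow>
     \<gamma> = (1 / real CARD('n)) * (1 + 1 / sqrt (real CARD('n) + 1)) \<or>
     \<gamma> = (1 / real CARD('n)) * (1 - 1 / sqrt (real CARD('n) + 1))"

definition ones :: "real ^ 'n::finite" where
  "ones = (\<chi> i. 1)"

definition simplex_V :: "real \<Rightarrow> real ^ 'n ^ 'n::finite" where
  "simplex_V \<gamma> =
     simplex_alpha TYPE('n) *\<^sub>R (mat 1 - \<gamma> *\<^sub>R (\<chi> i j. (ones :: real ^ 'n) $ i * (ones :: real ^ 'n) $ j))"

definition simplex_Vplus :: "real \<Rightarrow> real ^ ('n option) ^ 'n::finite" where
  "simplex_Vplus \<gamma> =
     (\<chi> i k. case k of Some j \<Rightarrow> simplex_V \<gamma> $ i $ j | None \<Rightarrow> - (simplex_V \<gamma> *v ones) $ i)"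

definition delta_f :: "real \<Rightarrow> (real ^ 'n \<Rightarrow> real) \<Rightarrow> real ^ 'n \<Rightarrow> real \<Rightarrow> real ^ ('n::finite option)" where
  "delta_f \<gamma> f x\<^sub>0 h = (\<chi> k. f (x\<^sub>0 + h *\<^sub>R column k (simplex_Vplus \<gamma>)) - f x\<^sub>0)"

definition simplex_gradient :: "real \<Rightarrow> (real ^ 'n \<Rightarrow> real) \<Rightarrow> real ^ 'n \<Rightarrow> real \<Rightarrow> real ^ 'n::finite" where
  "simplex_gradient \<gamma> f x\<^sub>0 h =
     (let Vp = (simplex_Vplus \<gamma> :: real ^ ('n option) ^ 'n)
      in (1 / h) *\<^sub>R ((matrix_inv (Vp ** transpose Vp) ** Vp) *v delta_f \<gamma> f x\<^sub>0 h))"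

definition extrapolated_gradient ::
  "real \<Rightarrow> (real ^ 'n \<Rightarrow> real) \<Rightarrow> real ^ 'n \<Rightarrow> real \<Rightarrow> real \<Rightarrow> real ^ 'n::finite" where
  "extrapolated_gradient \<gamma> f x\<^sub>0 h\<^sub>1 h\<^sub>2 =
     (1 / (h\<^sub>2 - h\<^sub>1)) *\<^sub>R
       (h\<^sub>2 *\<^sub>R simplex_gradient \<gamma> f x\<^sub>0 h\<^sub>1 - h\<^sub>1 *\<^sub>R simplex_gradient \<gamma> f x\<^sub>0 h\<^sub>2)"

text \<open>
  \<open>G\<close> is the Hessian of \<open>f\<close> at \<open>x\<^sub>0\<close>: \<open>f\<close> has a gradient near \<open>x\<^sub>0\<close>, and the gradient map is
  differentiable at \<open>x\<^sub>0\<close> with Jacobian \<open>G\<close>.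
\<close>

definition has_hessian_at :: "(real ^ 'n \<Rightarrow> real) \<Rightarrow> real ^ 'n ^ 'n \<Rightarrow> real ^ 'n::finite \<Rightarrow> bool" where
  "has_hessian_at f G x\<^sub>0 \<longleftrightarrow>
     (\<exists>g. (\<forall>\<^sub>F x in nhds x\<^sub>0. GDERIV f x :> g x) \<and> (g has_derivative (\<lambda>v. G *v v)) (at x\<^sub>0))"

end

theory Submission
  imports Defs
begin

text \<open>
  With \<open>V\<^sub>+ V\<^sub>+\<^sup>T = \<alpha>\<^sup>2 I\<close> the simplex gradient is a linear left inverse of \<open>V\<^sub>+\<^sup>T\<close> applied to difference
  quotients. Inserting the Taylor expansion gives \<open>g\<^sub>i = \<nabla>f(x\<^sub>0) + h\<^sub>i q + O(h\<^sub>i\<^sup>2)\<close> with the same vector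
  \<open>q\<close> for both steps, and the weights \<open>h\<^sub>2 / (h\<^sub>2 - h\<^sub>1)\<close> and \<open>- h\<^sub>1 / (h\<^sub>2 - h\<^sub>1)\<close> eliminate the linear
  term. What remains is \<open>O(h\<^sub>1 h\<^sub>2 (\<bar>h\<^sub>1\<bar> + \<bar>h\<^sub>2\<bar>) / \<bar>h\<^sub>2 - h\<^sub>1\<bar>)\<close>.
\<close>

lemma sum_option_UNIV:
  fixes F :: "'n::finite option \<Rightarrow> 'a::comm_monoid_add"
  shows "sum F UNIV = F None + (\<Sum>j\<in>UNIV. F (Some j))"
  by (simp add: UNIV_option_conv sum.reindex)

text \<open>Both admissible values satisfy \<open>n * \<gamma> - 1 = s\<close> up to sign, with
  \<open>s\<^sup>2 = 1 / (n + 1)\<close>. Squaring removes the sign, so a single identity serves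
  both choices of \<gamma>.\<close>

lemma simplex_gamma_quadratic:
  assumes "simplex_gamma TYPE('n::finite) \<gamma>"
  shows "(real CARD('n) + 1) * (real CARD('n) * \<gamma>\<^sup>2 - 2 * \<gamma>) = - 1"
proof -
  define n where "n = real CARD('n)"
  define s where "s = 1 / sqrt (n + 1)"
  have n: "n > 0" by (simp add: n_def)
  then have s2: "(n + 1) * s\<^sup>2 = 1"
    by (simp add: s_def power_divide)
  have "n * \<gamma> = 1 + s \<or> n * \<gamma> = 1 - s"
    using assms n by (auto simp: simplex_gamma_def n_def s_def)
  then have "(n * \<gamma> - 1)\<^sup>2 = s\<^sup>2"
    by (auto simp: power2_eq_square)
  then have "n * (n * \<gamma>\<^sup>2 - 2 * \<gamma>) = s\<^sup>2 - 1"
    by (simp add: power2_eq_square algebra_simps)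
  then have "(n + 1) * (n * (n * \<gamma>\<^sup>2 - 2 * \<gamma>)) = n * (- 1)"
    using s2 by (simp add: right_diff_distrib[of "n + 1" "s\<^sup>2"])
  then have "n * ((n + 1) * (n * \<gamma>\<^sup>2 - 2 * \<gamma>)) = n * (- 1)"
    by (simp only: mult.left_commute[of n "n + 1"])
  then show ?thesis
    using n unfolding n_def by (simp only: mult_cancel_left) auto
qed

lemma simplex_V_nth:
  "(simplex_V \<gamma> :: real ^ 'n ^ 'n::finite) $ i $ j =
     simplex_alpha TYPE('n) * ((if i = j then 1 else 0) - \<gamma>)"
  by (simp add: simplex_V_def ones_def mat_def)

lemma simplex_V_mult_ones:
  "((simplex_V \<gamma> :: real ^ 'n ^ 'n::finite) *v ones) $ i =
     simplex_alpha TYPE('n) * (1 - real CARD('n) * \<gamma>)"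
  by (simp add: matrix_vector_mult_def simplex_V_nth ones_def sum_subtractf
      flip: sum_distrib_left)

text \<open>Up to the factor \<open>\<alpha>\<^sup>2\<close>, the columns of \<open>V\<close>
  contribute \<open>n * \<gamma>\<^sup>2 - 2 * \<gamma>\<close> to every off-diagonal entry and the
  last arm contributes \<open>(1 - n * \<gamma>)\<^sup>2\<close>. The total is
  \<open>(n + 1) * (n * \<gamma>\<^sup>2 - 2 * \<gamma>) + 1\<close>, which the quadratic identity
  for \<gamma> makes zero.\<close>

lemma simplex_Vplus_mult_transpose:
  assumes "simplex_gamma TYPE('n::finite) \<gamma>"
  shows "(simplex_Vplus \<gamma> :: real ^ ('n option) ^ 'n) ** transpose (simplex_Vplus \<gamma>) =
           (simplex_alpha TYPE('n))\<^sup>2 *\<^sub>R mat 1"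
proof -
  define n where "n = real CARD('n)"
  define \<alpha> where "\<alpha> = simplex_alpha TYPE('n)"
  have "(\<Sum>k\<in>UNIV. (simplex_Vplus \<gamma> :: real ^ ('n option) ^ 'n) $ i $ k * simplex_Vplus \<gamma> $ j $ k)
      = \<alpha>\<^sup>2 * (if i = j then 1 else 0)" for i j :: 'n
  proof -
    \<comment> \<open>The product is expanded so that each term carries only one condition on
      \<open>k\<close> and can be summed as a Kronecker delta.\<close>
    have "(\<Sum>k\<in>UNIV. ((if i = k then 1 else 0) - \<gamma>) * ((if j = k then 1 else 0) - \<gamma>))
        = (\<Sum>k\<in>(UNIV::'n set). (if i = k then (if i = j then 1 else 0) - \<gamma> else 0)
              - (if j = k then \<gamma> else 0) + \<gamma>\<^sup>2)"
      by (rule sum.cong) (auto simp: power2_eq_square algebra_simps)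
    also have "\<dots> = (if i = j then 1 else 0) - 2 * \<gamma> + n * \<gamma>\<^sup>2"
      by (simp add: sum.distrib sum_subtractf n_def)
    finally have V: "(\<Sum>k\<in>UNIV. ((if i = k then 1 else 0) - \<gamma>) * ((if j = k then 1 else 0) - \<gamma>))
        = (if i = j then 1 else 0) - 2 * \<gamma> + n * \<gamma>\<^sup>2" .
    have "(\<Sum>k\<in>UNIV. (simplex_Vplus \<gamma> :: real ^ ('n option) ^ 'n) $ i $ k * simplex_Vplus \<gamma> $ j $ k)
        = \<alpha>\<^sup>2 * (1 - n * \<gamma>)\<^sup>2
          + (\<Sum>k\<in>UNIV. \<alpha>\<^sup>2 * (((if i = k then 1 else 0) - \<gamma>) * ((if j = k then 1 else 0) - \<gamma>)))"
      unfolding sum_option_UNIV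
      by (intro arg_cong2[where f = "(+)"] sum.cong)
        (simp_all add: simplex_Vplus_def simplex_V_nth simplex_V_mult_ones
          \<alpha>_def n_def power2_eq_square mult_ac)
    also have "\<dots> = \<alpha>\<^sup>2 * ((if i = j then 1 else 0) + ((n + 1) * (n * \<gamma>\<^sup>2 - 2 * \<gamma>) + 1))"
      unfolding sum_distrib_left[symmetric] V by (simp add: power2_eq_square algebra_simps)
    finally show ?thesis
      using simplex_gamma_quadratic[OF assms] by (simp add: n_def)
  qed
  then show ?thesis
    by (simp add: vec_eq_iff matrix_matrix_mult_def transpose_def mat_def \<alpha>_def)
qed

text \<open>The Gram matrix is a nonzero multiple of the identity, hence invertible, so least
  squares recovers a gradient exactly from its directional derivatives along the arms.\<close>

lemma simplex_left_inverse:
  fixes \<gamma> :: real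
  defines "Vp \<equiv> (simplex_Vplus \<gamma> :: real ^ ('n::finite option) ^ 'n)"
  assumes "simplex_gamma TYPE('n) \<gamma>"
  shows "(matrix_inv (Vp ** transpose Vp) ** Vp) *v (transpose Vp *v x) = x"
proof -
  have "simplex_alpha TYPE('n) \<noteq> 0"
    by (simp add: simplex_alpha_def add_nonneg_eq_0_iff)
  then have "invertible (Vp ** transpose Vp)"
    unfolding Vp_def simplex_Vplus_mult_transpose[OF assms(2)]
    by (intro scalar_invertible) (auto simp: invertible_def)
  then have "matrix_inv (Vp ** transpose Vp) ** (Vp ** transpose Vp) = mat 1"
    unfolding invertible_def matrix_inv_def by (rule someI2_ex) blast
  then show ?thesis
    by (simp add: matrix_vector_mul_assoc matrix_mul_assoc del: transpose_matrix_vector)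
qed

text \<open>The linear Taylor term is reproduced exactly, the quadratic one becomes
  \<open>h *\<^sub>R q\<close> after division by \<open>h\<close>, and the cubic remainder becomes
  quadratic. \<open>C\<close>, \<open>d\<close> and \<open>q\<close> are fixed before
  \<open>h\<close>, and both signs of \<open>h\<close> are allowed, so one \<open>q\<close> serves
  both simplices, reflected or not.\<close>

lemma simplex_gradient_expansion:
  fixes f :: "real ^ 'n \<Rightarrow> real" and x\<^sub>0 df :: "real ^ 'n::finite"
  assumes gamma: "simplex_gamma TYPE('n) \<gamma>"
    and taylor: "(\<lambda>x. f x - (f x\<^sub>0 + (x - x\<^sub>0) \<bullet> df + 1 / 2 * ((x - x\<^sub>0) \<bullet> (G *v (x - x\<^sub>0)))))
                   \<in> O[at x\<^sub>0](\<lambda>x. norm (x - x\<^sub>0) ^ 3)"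
  obtains C d q where "C \<ge> 0" "d > 0"
    "\<forall>h. h \<noteq> 0 \<longrightarrow> \<bar>h\<bar> < d \<longrightarrow> norm (simplex_gradient \<gamma> f x\<^sub>0 h - df - h *\<^sub>R q) \<le> C * h\<^sup>2"
proof -
  define Vp where "Vp = (simplex_Vplus \<gamma> :: real ^ ('n option) ^ 'n)"
  define L where "L = matrix_inv (Vp ** transpose Vp) ** Vp"
  define R where "R x = f x - (f x\<^sub>0 + (x - x\<^sub>0) \<bullet> df + 1 / 2 * ((x - x\<^sub>0) \<bullet> (G *v (x - x\<^sub>0))))" for x
  obtain c where c: "c > 0" "\<forall>\<^sub>F x in at x\<^sub>0. norm (R x) \<le> c * norm (norm (x - x\<^sub>0) ^ 3)"
    by (rule landau_o.bigE[OF taylor[folded R_def]])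
  then obtain \<delta> where \<delta>: "\<delta> > 0"
    and R_away: "\<And>x. x \<noteq> x\<^sub>0 \<Longrightarrow> dist x x\<^sub>0 < \<delta> \<Longrightarrow> \<bar>R x\<bar> \<le> c * norm (x - x\<^sub>0) ^ 3"
    unfolding eventually_at by (auto simp del: norm_le_zero_iff)
  \<comment> \<open>The filter \<open>at x\<^sub>0\<close> leaves out the centre, but the remainder
    vanishes there, so the bound extends to it.\<close>
  have R_bound: "\<bar>R x\<bar> \<le> c * norm (x - x\<^sub>0) ^ 3" if "dist x x\<^sub>0 < \<delta>" for x
    using R_away[of x] that by (cases "x = x\<^sub>0") (auto simp: R_def)
  \<comment> \<open>A crude common bound on the arm lengths; the summand 1 makes it positive, so
    that \<open>\<delta> / B\<close> is a valid radius.\<close>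
  define B where "B = 1 + (\<Sum>k\<in>UNIV. norm (column k Vp))"
  have B: "B > 0" "norm (column k Vp) \<le> B" for k
    unfolding B_def using member_le_sum[of k UNIV "\<lambda>k. norm (column k Vp)"]
    by (auto intro!: add_pos_nonneg sum_nonneg)
  obtain K where K: "K > 0" "\<And>y. norm (L *v y) \<le> norm y * K"
    using bounded_linear.pos_bounded[OF matrix_vector_mul_bounded_linear[of L]] by blast
  define u where "u = (\<chi> k. column k Vp \<bullet> (G *v column k Vp))"
  define q where "q = (1 / 2) *\<^sub>R (L *v u)"
  define N where "N = real CARD('n option)"
  show thesis
  \<comment> \<open>The radius \<open>\<delta> / B\<close> keeps every vertex in the region of the
    Taylor bound. In the constant, \<open>c * B ^ 3\<close> bounds one component of the remainder,
    \<open>N\<close> counts components and \<open>K\<close> bounds the operator norm of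
    \<open>L\<close>.\<close>
  proof (rule that[of "N * (c * B ^ 3) * K" "\<delta> / B" q])
    show "N * (c * B ^ 3) * K \<ge> 0" "\<delta> / B > 0"
      using c(1) B(1) K(1) \<delta> by (simp_all add: N_def)
  next
    show "\<forall>h. h \<noteq> 0 \<longrightarrow> \<bar>h\<bar> < \<delta> / B \<longrightarrow>
        norm (simplex_gradient \<gamma> f x\<^sub>0 h - df - h *\<^sub>R q) \<le> N * (c * B ^ 3) * K * h\<^sup>2"
    proof (intro allI impI)
      fix h :: real
      assume h: "h \<noteq> 0" "\<bar>h\<bar> < \<delta> / B"
      define r where "r = (\<chi> k. R (x\<^sub>0 + h *\<^sub>R column k Vp))"
      have "transpose Vp $ k = column k Vp" for k
        by (simp add: vec_eq_iff transpose_def column_def)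
      then have "delta_f \<gamma> f x\<^sub>0 h $ k = (h *\<^sub>R (transpose Vp *v df) + (h\<^sup>2 / 2) *\<^sub>R u + r) $ k" for k
        by (simp add: delta_f_def r_def R_def u_def matrix_vector_mul_component Vp_def[symmetric]
            matrix_vector_mult_scaleR power2_eq_square del: transpose_matrix_vector)
      then have "delta_f \<gamma> f x\<^sub>0 h = h *\<^sub>R (transpose Vp *v df) + (h\<^sup>2 / 2) *\<^sub>R u + r"
        unfolding vec_eq_iff by blast
      moreover have "L *v (transpose Vp *v df) = df"
        unfolding L_def Vp_def by (rule simplex_left_inverse[OF gamma])
      ultimately have "L *v delta_f \<gamma> f x\<^sub>0 h = h *\<^sub>R df + (h\<^sup>2 / 2) *\<^sub>R (L *v u) + L *v r"
        by (simp add: matrix_vector_right_distrib matrix_vector_mult_scaleR)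
      moreover have "simplex_gradient \<gamma> f x\<^sub>0 h = (1 / h) *\<^sub>R (L *v delta_f \<gamma> f x\<^sub>0 h)"
        by (simp add: simplex_gradient_def Let_def L_def Vp_def)
      ultimately have eq: "simplex_gradient \<gamma> f x\<^sub>0 h - df - h *\<^sub>R q = (1 / h) *\<^sub>R (L *v r)"
        using h(1) by (simp add: q_def algebra_simps power2_eq_square)
      have "\<bar>r $ k\<bar> \<le> c * B ^ 3 * \<bar>h\<bar> ^ 3" for k
      proof -
        have "\<bar>h\<bar> * norm (column k Vp) \<le> \<bar>h\<bar> * B"
          using B(2) by (simp add: mult_left_mono)
        also have "\<dots> < \<delta>"
          using h(2) B(1) by (simp add: field_simps)
        finally have "\<bar>r $ k\<bar> \<le> c * (\<bar>h\<bar> * norm (column k Vp)) ^ 3"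
          using R_bound[of "x\<^sub>0 + h *\<^sub>R column k Vp"] by (simp add: r_def dist_norm)
        also have "\<dots> \<le> c * (\<bar>h\<bar> * B) ^ 3"
          using c(1) B(2) by (intro mult_left_mono power_mono) auto
        finally show ?thesis
          by (simp add: power_mult_distrib mult_ac)
      qed
      then have "(\<Sum>k\<in>UNIV. \<bar>r $ k\<bar>) \<le> (\<Sum>k\<in>(UNIV :: 'n option set). c * B ^ 3 * \<bar>h\<bar> ^ 3)"
        by (intro sum_mono)
      \<comment> \<open>The Euclidean norm is at most the sum of the absolute components.\<close>
      then have "norm r \<le> N * (c * B ^ 3 * \<bar>h\<bar> ^ 3)"
        using norm_le_l1_cart[of r] by (simp add: N_def del: card_option)
      then have "norm (L *v r) \<le> N * (c * B ^ 3 * \<bar>h\<bar> ^ 3) * K"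
        using K by (meson mult_right_mono less_imp_le order_trans)
      then have "norm ((1 / h) *\<^sub>R (L *v r)) \<le> N * (c * B ^ 3 * \<bar>h\<bar> ^ 3) * K / \<bar>h\<bar>"
        by (simp add: divide_right_mono)
      also have "\<dots> = N * (c * B ^ 3) * K * h\<^sup>2"
        using h(1) by (simp add: power2_eq_square power3_eq_cube abs_mult_self_eq)
      finally show "norm (simplex_gradient \<gamma> f x\<^sub>0 h - df - h *\<^sub>R q) \<le> N * (c * B ^ 3) * K * h\<^sup>2"
        unfolding eq .
    qed
  qed
qed

text \<open>The terms \<open>b * a\<close> and \<open>a * b\<close> in front of \<open>q\<close>
  cancel, so only the two error vectors survive. The hypothesis with \<open>K\<close> controls the
  small denominator \<open>b - a\<close>.\<close>

lemma extrapolation_error: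
  fixes g\<^sub>1 g\<^sub>2 g q :: "'a::real_normed_vector"
  assumes "a \<noteq> b" "norm (g\<^sub>1 - g - a *\<^sub>R q) \<le> C * a\<^sup>2" "norm (g\<^sub>2 - g - b *\<^sub>R q) \<le> C * b\<^sup>2"
    and "\<bar>a\<bar> \<le> K * \<bar>b - a\<bar>" "C \<ge> 0"
  shows "norm (g - (1 / (b - a)) *\<^sub>R (b *\<^sub>R g\<^sub>1 - a *\<^sub>R g\<^sub>2)) \<le> C * K * \<bar>b\<bar> * (\<bar>a\<bar> + \<bar>b\<bar>)"
proof -
  define e\<^sub>1 where "e\<^sub>1 = g\<^sub>1 - g - a *\<^sub>R q"
  define e\<^sub>2 where "e\<^sub>2 = g\<^sub>2 - g - b *\<^sub>R q"
  have "b *\<^sub>R g\<^sub>1 - a *\<^sub>R g\<^sub>2 = (b - a) *\<^sub>R g + (b *\<^sub>R e\<^sub>1 - a *\<^sub>R e\<^sub>2)"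
    by (simp add: e\<^sub>1_def e\<^sub>2_def algebra_simps)
  then have "g - (1 / (b - a)) *\<^sub>R (b *\<^sub>R g\<^sub>1 - a *\<^sub>R g\<^sub>2) = (1 / (b - a)) *\<^sub>R (a *\<^sub>R e\<^sub>2 - b *\<^sub>R e\<^sub>1)"
    using assms(1) by (simp add: scaleR_add_right scaleR_diff_right)
  then have eq: "norm (g - (1 / (b - a)) *\<^sub>R (b *\<^sub>R g\<^sub>1 - a *\<^sub>R g\<^sub>2)) = norm (a *\<^sub>R e\<^sub>2 - b *\<^sub>R e\<^sub>1) / \<bar>b - a\<bar>"
    by simp
  have "norm (a *\<^sub>R e\<^sub>2 - b *\<^sub>R e\<^sub>1) \<le> \<bar>a\<bar> * (C * b\<^sup>2) + \<bar>b\<bar> * (C * a\<^sup>2)"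
    using assms(2,3) unfolding e\<^sub>1_def[symmetric] e\<^sub>2_def[symmetric]
    by (intro norm_triangle_le_diff add_mono) (auto intro: mult_left_mono)
  \<comment> \<open>A factor \<open>\<bar>a\<bar>\<close> is split off to be traded for
    \<open>K * \<bar>b - a\<bar>\<close>; what is left is still of second order in the
    steps.\<close>
  also have "\<dots> = \<bar>a\<bar> * (C * \<bar>b\<bar> * (\<bar>a\<bar> + \<bar>b\<bar>))"
    unfolding power2_abs[of a, symmetric] power2_abs[of b, symmetric]
    by (simp add: power2_eq_square algebra_simps del: abs_mult_self_eq)
  also have "\<dots> \<le> K * \<bar>b - a\<bar> * (C * \<bar>b\<bar> * (\<bar>a\<bar> + \<bar>b\<bar>))"
    using assms(4,5) by (intro mult_right_mono) auto
  also have "\<dots> = C * K * \<bar>b\<bar> * (\<bar>a\<bar> + \<bar>b\<bar>) * \<bar>b - a\<bar>"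
    by (simp only: mult_ac)
  finally show ?thesis
    unfolding eq using assms(1) by (simp only: pos_divide_le_eq zero_less_abs_iff right_minus_eq not_sym simp_thms)
qed

theorem mainTheorem4:
  fixes f :: "real ^ 'n \<Rightarrow> real"
    and x\<^sub>0 df :: "real ^ 'n"
    and G :: "real ^ 'n ^ 'n"
    and \<gamma> :: real
    and h\<^sub>1 h\<^sub>2 :: "real \<Rightarrow> real"
  assumes gamma: "simplex_gamma TYPE('n) \<gamma>"
    and gradient: "GDERIV f x\<^sub>0 :> df"
    and hessian: "has_hessian_at f G x\<^sub>0"
    and taylor: "(\<lambda>x. f x - (f x\<^sub>0 + (x - x\<^sub>0) \<bullet> df + 1 / 2 * ((x - x\<^sub>0) \<bullet> (G *v (x - x\<^sub>0)))))
                   \<in> O[at x\<^sub>0](\<lambda>x. norm (x - x\<^sub>0) ^ 3)"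
    and h1_order: "h\<^sub>1 \<in> O[at_right 0](\<lambda>h. h)"
    and h2_order: "h\<^sub>2 \<in> O[at_right 0](\<lambda>h. h)"
    and nonzero: "\<forall>\<^sub>F h in at_right 0. h\<^sub>1 h \<noteq> 0 \<and> h\<^sub>2 h \<noteq> 0"
    and distinct: "\<forall>\<^sub>F h in at_right 0. h\<^sub>1 h \<noteq> h\<^sub>2 h"
    \<comment> \<open>The steps stay distinct relative to their size; the Taylor hypothesis alone does not
        give the estimate when \<open>h\<^sub>2 / h\<^sub>1\<close> tends to 1. For \<open>h\<^sub>2 = \<eta> h\<^sub>1\<close> this just says \<open>\<eta> \<noteq> 1\<close>.\<close>
    and separated: "h\<^sub>1 \<in> O[at_right 0](\<lambda>h. h\<^sub>2 h - h\<^sub>1 h)"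
  shows "(\<lambda>h. norm (df - extrapolated_gradient \<gamma> f x\<^sub>0 (h\<^sub>1 h) (h\<^sub>2 h))) \<in> O[at_right 0](\<lambda>h. h ^ 2)
    \<and> (\<forall>\<eta> a b. \<eta> \<noteq> 1 \<and> a \<noteq> 0 \<and> b \<noteq> 0 \<and> b = \<eta> * a \<longrightarrow>
        extrapolated_gradient \<gamma> f x\<^sub>0 a b =
          (\<eta> / (\<eta> - 1)) *\<^sub>R simplex_gradient \<gamma> f x\<^sub>0 a - (1 / (\<eta> - 1)) *\<^sub>R simplex_gradient \<gamma> f x\<^sub>0 b)"
proof (intro conjI allI impI)
  obtain C d q where C: "C \<ge> 0" and d: "d > 0"
    and expansion: "\<forall>h. h \<noteq> 0 \<longrightarrow> \<bar>h\<bar> < d \<longrightarrow>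
          norm (simplex_gradient \<gamma> f x\<^sub>0 h - df - h *\<^sub>R q) \<le> C * h\<^sup>2"
    by (rule simplex_gradient_expansion[OF gamma taylor])
  obtain K where K: "K > 0" "\<forall>\<^sub>F h in at_right 0. norm (h\<^sub>1 h) \<le> K * norm (h\<^sub>2 h - h\<^sub>1 h)"
    by (rule landau_o.bigE[OF separated])
  \<comment> \<open>A step of order \<open>h\<close> tends to 0 and so eventually falls within the
    radius of the expansion.\<close>
  have small: "\<forall>\<^sub>F h in at_right 0. \<bar>k h\<bar> < d" if k: "k \<in> O[at_right 0](\<lambda>h. h)" for k :: "real \<Rightarrow> real"
  proof -
    obtain c where "\<forall>\<^sub>F h in at_right 0. norm (k h) \<le> c * norm h"
      by (rule landau_o.bigE[OF k])
    moreover have "((\<lambda>h. c * norm h) \<longlongrightarrow> 0) (at_right (0 :: real))"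
      by (auto intro!: tendsto_eq_intros)
    ultimately have "(k \<longlongrightarrow> 0) (at_right 0)"
      by (rule Lim_null_comparison)
    then show ?thesis
      using d by (auto dest: tendstoD simp: dist_real_def)
  qed
  have "\<forall>\<^sub>F h in at_right 0. norm (df - extrapolated_gradient \<gamma> f x\<^sub>0 (h\<^sub>1 h) (h\<^sub>2 h))
      \<le> C * K * (\<bar>h\<^sub>2 h\<bar> * (\<bar>h\<^sub>1 h\<bar> + \<bar>h\<^sub>2 h\<bar>))"
    using nonzero distinct K(2) small[OF h1_order] small[OF h2_order]
  proof eventually_elim
    case (elim h)
    then show ?case
      using extrapolation_error[OF _ expansion[rule_format] expansion[rule_format] _ C, of "h\<^sub>1 h" "h\<^sub>2 h" K]
      by (simp add: extrapolated_gradient_def mult_ac)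
  qed
  then have "(\<lambda>h. norm (df - extrapolated_gradient \<gamma> f x\<^sub>0 (h\<^sub>1 h) (h\<^sub>2 h)))
      \<in> O[at_right 0](\<lambda>h. \<bar>h\<^sub>2 h\<bar> * (\<bar>h\<^sub>1 h\<bar> + \<bar>h\<^sub>2 h\<bar>))"
    by (intro bigoI[of _ "C * K"]) (auto simp: abs_mult)
  also have "(\<lambda>h. \<bar>h\<^sub>2 h\<bar> * (\<bar>h\<^sub>1 h\<bar> + \<bar>h\<^sub>2 h\<bar>)) \<in> O[at_right 0](\<lambda>h. h * h)"
    using h1_order h2_order by (intro landau_o.big.mult sum_in_bigo) auto
  finally show "(\<lambda>h. norm (df - extrapolated_gradient \<gamma> f x\<^sub>0 (h\<^sub>1 h) (h\<^sub>2 h))) \<in> O[at_right 0](\<lambda>h. h ^ 2)"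
    by (simp add: power2_eq_square)
next
  fix \<eta> a b :: real
  assume "\<eta> \<noteq> 1 \<and> a \<noteq> 0 \<and> b \<noteq> 0 \<and> b = \<eta> * a"
  \<comment> \<open>Since \<open>b - a = (\<eta> - 1) * a\<close>, the nonzero factor
    \<open>a\<close> cancels from both weights.\<close>
  then have "b / (b - a) = \<eta> / (\<eta> - 1)" "a / (b - a) = 1 / (\<eta> - 1)"
    by (auto simp: field_simps)
  then show "extrapolated_gradient \<gamma> f x\<^sub>0 a b =
      (\<eta> / (\<eta> - 1)) *\<^sub>R simplex_gradient \<gamma> f x\<^sub>0 a - (1 / (\<eta> - 1)) *\<^sub>R simplex_gradient \<gamma> f x\<^sub>0 b"
    by (simp add: extrapolated_gradient_def scaleR_diff_right)
qed

end
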